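(* Let $n\ge 2$ and $1\le k\le n$. Then the number of arithmetical structures $(\mathbf{d},\mathbf{r})$ on the cycle $\mathcal{C}_n$ with $\mathbf{r}(1)=k$ equals \[\binom{2n-k-1}{n-k},\] the number of multisubsets of size $n-k$ of $\{1,\dots,n\}$. In particular, the total number of arithmetical structures on $\mathcal{C}_n$ is $\binom{2n-1}{n-1}$.
   Context: For $n\ge 3$, $\mathcal{C}_n$ is the cycle graph with vertices $1,\dots,n$ and edges $\{i,i+1\}$ (indices mod $n$); $\mathcal{C}_2$ is two vertices joined by two parallel edges (adjacency matrix $\begin{pmatrix}0&2\\2&0\end{pmatrix}$). An arithmetical structure on $\mathcal{C}_n$ is a pair $(\mathbf{d},\mathbf{r})$ of positive integer vectors in $\mathbb{Z}^n$ with $\mathbf{r}$ primitive (gcd of entries $1$) and $(\operatorname{diag}(\mathbf{d})-A)\mathbf{r}=\mathbf{0}$, $A$ the adjacency matrix. $\mathbf{r}(1)=\#\{i:r_i=1\}$. *)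

theory Defs
  imports "Jordan_Normal_Form.Matrix" "HOL-Library.Multiset"
begin

text \<open>Vertices are numbered \<open>0, \<dots>, n - 1\<close>, matching the index convention of
  the vector and matrix types; all matrices and vectors are over the integers.\<close>

definition cycle_edges :: "nat \<Rightarrow> nat set set" where
  "cycle_edges n = {{i, (i + 1) mod n} | i. i < n}"

text \<open>A set of edges cannot record the two parallel edges of the cycle on two vertices,
  so its adjacency matrix is given explicitly.\<close>

definition cycle_adj :: "nat \<Rightarrow> int mat" where
  "cycle_adj n =
     (if n = 2 then mat_of_rows_list 2 [[0, 2], [2, 0]]
      else mat n n (\<lambda>(i, j). if {i, j} \<in> cycle_edges n then 1 else 0))"

definition arithmetical_structures :: "nat \<Rightarrow> int mat \<Rightarrow> (int vec \<times> int vec) set" where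
  "arithmetical_structures n A =
     {(d, r). d \<in> carrier_vec n \<and> r \<in> carrier_vec n \<and>
        (\<forall>i<n. d $ i > 0) \<and> (\<forall>i<n. r $ i > 0) \<and>
        Gcd (set\<^sub>v r) = 1 \<and>
        (mat_diag n (\<lambda>i. d $ i) - A) *\<^sub>v r = 0\<^sub>v n}"

definition num_ones :: "int vec \<Rightarrow> nat" where
  "num_ones r = card {i. i < dim_vec r \<and> r $ i = 1}"

end

theory Submission
  imports Defs
begin

text \<open>Unless all entries agree, some entry exceeds its predecessor and is at least its
  successor. It divides the sum of these two neighbours, which is less than twice the entry,
  so it equals that sum, and deleting it leaves a structure on a shorter cycle. Every
  structure therefore arises from a constant one by repeatedly inserting the sum of two
  neighbours, and each inserted vertex is charged to the vertex that was to its left at that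
  moment. The number \<open>x\<^sub>i\<close> of vertices charged to \<open>i\<close> is \<open>\<lceil>r\<^sub>i\<^sub>+\<^sub>1 / r\<^sub>i\<rceil> - 1\<close>, and the
  insertions can be undone from \<open>x\<close> alone. As insertions never create ones, the structures
  with \<open>k\<close> ones correspond to the sequences \<open>x\<close> of \<open>n\<close> natural numbers with sum \<open>n - k\<close>.\<close>

text \<open>Only the vector \<open>r\<close> is recorded, as a list read cyclically, since it determines \<open>d\<close>.
  Length 1 is allowed: the single vertex is then both of its own neighbours, so that the deletion step also applies to the cycle on two vertices.\<close>

definition neighbour_sum :: "int list \<Rightarrow> nat \<Rightarrow> int" where
  "neighbour_sum r i = r ! ((i + length r - 1) mod length r) + r ! (Suc i mod length r)"

definition cyclic_structure :: "int list \<Rightarrow> bool" where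
  "cyclic_structure r \<longleftrightarrow> r \<noteq> [] \<and> (\<forall>x\<in>set r. x > 0) \<and> Gcd (set r) = 1 \<and>
     (\<forall>i<length r. r ! i dvd neighbour_sum r i)"

text \<open>For positive \<open>u\<close> and \<open>v\<close> the quotient is \<open>\<lceil>v / u\<rceil> - 1\<close>.\<close>

definition multiplicities :: "int list \<Rightarrow> nat list" where
  "multiplicities r = map2 (\<lambda>u v. nat ((v - 1) div u)) r (rotate1 r)"

section \<open>Structures and multiplicities under rotation\<close>

lemma cyclic_structureD:
  assumes "cyclic_structure r"
  shows "r \<noteq> []" "\<And>x. x \<in> set r \<Longrightarrow> x > 0" "Gcd (set r) = 1"
    "\<And>i. i < length r \<Longrightarrow> r ! i dvd neighbour_sum r i"
  using assms by (auto simp: cyclic_structure_def)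

lemma length_multiplicities [simp]: "length (multiplicities r) = length r"
  by (simp add: multiplicities_def)

lemma nth_multiplicities:
  "i < length r \<Longrightarrow> multiplicities r ! i = nat ((r ! (Suc i mod length r) - 1) div r ! i)"
  by (simp add: multiplicities_def nth_rotate1)

lemma multiplicities_rotate1: "multiplicities (rotate1 r) = rotate1 (multiplicities r)"
proof (rule nth_equalityI)
  fix i assume "i < length (multiplicities (rotate1 r))"
  then have i: "i < length r" by simp
  then have "Suc i mod length r < length r" by (metis gr_implies_not0 mod_less_divisor not_gr0)
  with i show "multiplicities (rotate1 r) ! i = rotate1 (multiplicities r) ! i"
    by (simp add: nth_multiplicities nth_rotate1)
qed simp

lemma multiplicities_rotate: "multiplicities (rotate j r) = rotate j (multiplicities r)"
  by (induction j) (simp_all add: multiplicities_rotate1)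

lemma neighbour_sum_rotate1:
  assumes "i < length r"
  shows "neighbour_sum (rotate1 r) i = neighbour_sum r (Suc i mod length r)"
proof -
  let ?n = "length r"
  have n: "?n > 0" using assms by auto
  \<comment> \<open>Both sides equal \<open>i\<close>; the wrap-around \<open>Suc i = ?n\<close> is
    treated apart.\<close>
  have "Suc ((i + ?n - 1) mod ?n) mod ?n = (Suc i mod ?n + ?n - 1) mod ?n"
  proof (cases "Suc i = ?n")
    case True
    then have "(i + ?n - 1) mod ?n = (i - 1) mod ?n \<or> ?n = 1"
      by (metis Nat.add_diff_assoc2 One_nat_def Suc_leI mod_add_self2 not_gr_zero)
    then show ?thesis using True n by (auto simp: mod_Suc)
  next
    case False
    then have "Suc i < ?n" using assms by simp
    then show ?thesis using n by (simp add: mod_Suc_eq)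
  qed
  moreover have "(i + ?n - 1) mod ?n < ?n" "Suc i mod ?n < ?n" using n by simp_all
  ultimately show ?thesis
    by (simp add: neighbour_sum_def nth_rotate1)
qed

lemma cyclic_structure_rotate1:
  assumes "cyclic_structure r"
  shows "cyclic_structure (rotate1 r)"
proof -
  have "rotate1 r ! i dvd neighbour_sum (rotate1 r) i" if "i < length r" for i
  proof -
    have "Suc i mod length r < length r" using that by (intro mod_less_divisor) auto
    then show ?thesis
      using that cyclic_structureD(4)[OF assms]
      by (simp add: neighbour_sum_rotate1 nth_rotate1)
  qed
  with assms show ?thesis by (simp add: cyclic_structure_def)
qed

lemma cyclic_structure_rotate: "cyclic_structure r \<Longrightarrow> cyclic_structure (rotate j r)"
  by (induction j) (auto intro: cyclic_structure_rotate1)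

section \<open>Rotating a list into a convenient position\<close>

lemma sum_list_rotate1: "sum_list (rotate1 xs) = sum_list (xs :: 'a :: comm_monoid_add list)"
  by (cases xs) (simp_all add: add.commute)

lemma rotate_inverse: "\<exists>k. rotate k (rotate j xs) = xs"
proof (intro exI)
  show "rotate (length xs - j mod length xs) (rotate j xs) = xs"
  proof (cases "xs = []")
    case False
    then have "length xs - j mod length xs + j mod length xs = length xs"
      by (simp add: less_imp_le)
    then have "rotate (length xs - j mod length xs) (rotate (j mod length xs) xs) = xs"
      by (simp add: rotate_rotate)
    then show ?thesis by (metis rotate_conv_mod)
  qed simp
qed

text \<open>Lets an argument use whichever rotation is convenient: rotating further leads back to
  \<open>xs\<close>.\<close>

lemma rotate_induct:
  assumes "\<And>xs. P xs \<Longrightarrow> P (rotate1 xs)" "P (rotate j xs)"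
  shows "P xs"
proof -
  obtain k where "rotate k (rotate j xs) = xs" using rotate_inverse by blast
  moreover have "P (rotate k (rotate j xs))"
    by (induction k) (use assms in auto)
  ultimately show ?thesis by simp
qed

text \<open>Otherwise being nonzero would spread from \<open>y\<close> all round the cycle. The
  shape puts the vertex to be deleted at the head and the one it is charged to at the end.\<close>

lemma ex_rotate_hd_zero:
  fixes x :: "nat list"
  assumes "0 \<in> set x" "y \<in> set x" "y \<noteq> 0"
  shows "\<exists>j z q. rotate j x = 0 # z @ [Suc q]"
proof -
  have ne: "x \<noteq> []" using assms by auto
  have "\<exists>j. hd (rotate j x) \<noteq> 0 \<and> hd (rotate (Suc j) x) = 0"
  proof (rule ccontr)
    assume no: "\<not> ?thesis"
    have step: "hd (rotate (Suc j) x) \<noteq> 0" if "hd (rotate j x) \<noteq> 0" for j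
      using no[unfolded not_ex, THEN spec[of _ j]] that by argo
    obtain p where p: "p < length x" "x ! p = y" using assms by (metis in_set_conv_nth)
    obtain q where q: "q < length x" "x ! q = 0" using assms by (metis in_set_conv_nth)
    have "hd (rotate (p + k) x) \<noteq> 0" for k
    proof (induction k)
      case 0
      then show ?case using p assms ne by (simp add: hd_rotate_conv_nth)
    next
      case (Suc k)
      then show ?case using step[of "p + k"] by simp
    qed
    \<comment> \<open>The number of steps from \<open>p\<close> to \<open>q\<close>; adding
      \<open>length x\<close> keeps the subtraction from truncating.\<close>
    from this[of "q + length x - p"] show False
      using p q ne by (simp add: hd_rotate_conv_nth)
  qed
  then obtain j where j: "hd (rotate j x) \<noteq> 0" "hd (rotate (Suc j) x) = 0" by blast
  obtain a w where w: "rotate j x = a # w" using ne by (metis neq_Nil_conv rotate_is_Nil_conv)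
  have r: "rotate (Suc j) x = w @ [a]" using w by simp
  have "a \<noteq> 0" using j w by simp
  moreover from this obtain z where "w = 0 # z" using j r by (cases w) auto
  ultimately show ?thesis using r by (metis append_Cons not0_implies_Suc)
qed

section \<open>Inserting and deleting the sum of two neighbours\<close>

lemma multiplicities_Cons:
  assumes "rs \<noteq> []"
  shows "multiplicities (z # rs) =
    nat ((hd rs - 1) div z) # butlast (multiplicities rs) @ [nat ((z - 1) div last rs)]"
    and "last (multiplicities rs) = nat ((hd rs - 1) div last rs)"
proof -
  obtain us a where rs: "rs = us @ [a]" using assms by (metis rev_exhaust)
  obtain b ts where rs': "rs = b # ts" using assms by (metis neq_Nil_conv)
  have len: "length ts = length us" using rs rs' by (metis length_append_singleton length_Cons nat.inject)
  \<comment> \<open>Splitting the first list at its end and the second at its head isolates the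
    wrap-around pair \<open>(a, b)\<close>, the only one that prepending \<open>z\<close> breaks
    up.\<close>
  have m: "multiplicities rs = map2 (\<lambda>u v. nat ((v - 1) div u)) us ts @ [nat ((b - 1) div a)]"
    by (subst multiplicities_def, subst (2) rs', subst rs) (simp add: len)
  have "zip rs (ts @ [z]) = zip us ts @ [(a, z)]"
    by (subst rs) (simp add: len)
  then have "multiplicities (z # rs) = nat ((b - 1) div z) #
    map2 (\<lambda>u v. nat ((v - 1) div u)) us ts @ [nat ((z - 1) div a)]"
    by (simp add: multiplicities_def rs')
  moreover have "last rs = a" by (simp add: rs)
  moreover have "hd rs = b" by (simp add: rs')
  ultimately show "multiplicities (z # rs) =
    nat ((hd rs - 1) div z) # butlast (multiplicities rs) @ [nat ((z - 1) div last rs)]"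
    and "last (multiplicities rs) = nat ((hd rs - 1) div last rs)"
    by (simp_all add: m)
qed

text \<open>The new entry exceeds its successor, hence the 0. The successor of the last vertex grows
  by \<open>last rs\<close>, which raises that quotient by exactly one.\<close>

lemma multiplicities_subdivide:
  assumes "rs \<noteq> []" "\<And>x. x \<in> set rs \<Longrightarrow> x > 0"
  shows "multiplicities ((last rs + hd rs) # rs) =
    0 # butlast (multiplicities rs) @ [Suc (last (multiplicities rs))]"
proof -
  have pos: "last rs > 0" "hd rs > 0" using assms by auto
  have "(last rs + hd rs - 1) div last rs = (hd rs - 1) div last rs + 1"
    using pos by (metis add.commute add_diff_eq div_add_self1 less_irrefl)
  moreover have "(hd rs - 1) div last rs \<ge> 0"
    using pos by (intro pos_imp_zdiv_nonneg_iff[THEN iffD2]) auto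
  ultimately show ?thesis
    using pos by (simp add: multiplicities_Cons[OF assms(1)] nat_add_distrib)
qed

text \<open>A vertex next to the insertion sees a neighbour's value grow by its own entry, so its
  neighbour sum is unchanged modulo that entry. In length 1 this happens on both sides.\<close>

lemma neighbour_sum_subdivide:
  assumes "rs \<noteq> []" "j < length rs"
  shows "rs ! j dvd neighbour_sum ((last rs + hd rs) # rs) (Suc j) \<longleftrightarrow>
    rs ! j dvd neighbour_sum rs j"
proof -
  let ?m = "length rs" and ?z = "last rs + hd rs"
  have l: "(?z # rs) ! ((Suc j + length (?z # rs) - 1) mod length (?z # rs)) =
    rs ! ((j + ?m - 1) mod ?m) + (if j = 0 then rs ! j else 0)"
  proof (cases j)
    case 0
    then show ?thesis using assms by (simp add: last_conv_nth hd_conv_nth)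
  next
    case (Suc i)
    have "(j + ?m - 1) mod ?m = i" using Suc assms by simp
    moreover have "(Suc j + length (?z # rs) - 1) mod length (?z # rs) = Suc i"
      using Suc assms by (simp add: mod_if)
    ultimately show ?thesis using Suc by simp
  qed
  have r: "(?z # rs) ! (Suc (Suc j) mod length (?z # rs)) =
    rs ! (Suc j mod ?m) + (if Suc j = ?m then rs ! j else 0)"
  proof (cases "Suc j = ?m")
    case True
    then have "last rs = rs ! j" using assms by (simp add: last_conv_nth flip: True)
    then show ?thesis using assms True by (simp add: hd_conv_nth)
  next
    case False
    then show ?thesis using assms by simp
  qed
  define e where "e = (if j = 0 then rs ! j else 0) + (if Suc j = ?m then rs ! j else 0)"
  have "neighbour_sum (?z # rs) (Suc j) = neighbour_sum rs j + e"
    unfolding neighbour_sum_def l r e_def by (simp only: add_ac)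
  moreover have "rs ! j dvd e" by (simp add: e_def)
  ultimately show ?thesis by (simp add: dvd_add_left_iff)
qed

text \<open>The inserted entry equals its own neighbour sum and, as a sum of old entries, leaves the
  gcd unchanged. Right to left this is insertion, left to right deletion.\<close>

lemma cyclic_structure_subdivide:
  assumes "rs \<noteq> []" "last rs > 0"
  shows "cyclic_structure ((last rs + hd rs) # rs) \<longleftrightarrow> cyclic_structure rs"
proof -
  let ?z = "last rs + hd rs"
  have mem: "last rs \<in> set rs" "hd rs \<in> set rs" using assms by auto
  then have "Gcd (set rs) dvd ?z" by (intro dvd_add Gcd_dvd)
  then have g: "Gcd (set (?z # rs)) = Gcd (set rs)" by simp
  have "?z dvd neighbour_sum (?z # rs) 0"
    using assms by (simp add: neighbour_sum_def last_conv_nth hd_conv_nth)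
  then have "(\<forall>i<length (?z # rs). (?z # rs) ! i dvd neighbour_sum (?z # rs) i) \<longleftrightarrow>
      (\<forall>j<length rs. rs ! j dvd neighbour_sum rs j)"
    by (simp add: All_less_Suc2 neighbour_sum_subdivide[OF assms(1)])
  moreover have "(\<forall>x\<in>set (?z # rs). x > 0) \<longleftrightarrow> (\<forall>x\<in>set rs. x > 0)"
    using mem by (auto intro: add_pos_pos)
  ultimately show ?thesis unfolding cyclic_structure_def g using assms(1) by simp
qed

text \<open>Read as quotients, the leading 0 gives \<open>hd rs \<le> z\<close> and the trailing
  \<open>Suc q\<close> gives \<open>last rs < z\<close>, where \<open>z\<close> heads
  \<open>r\<close>; divisibility then forces \<open>z\<close> to be the sum of its
  neighbours.\<close>

lemma cyclic_structure_reduce: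
  assumes r: "cyclic_structure r" and m: "multiplicities r = 0 # y @ [Suc q]"
  obtains rs where "rs \<noteq> []" "r = (last rs + hd rs) # rs" "cyclic_structure rs"
    "multiplicities rs = y @ [q]"
proof -
  have "length r = Suc (Suc (length y))" using arg_cong[OF m, of length] by simp
  then obtain z rs where zrs: "r = z # rs" "rs \<noteq> []" by (metis Suc_length_conv list.distinct(1))
  have "last rs \<in> set rs" "hd rs \<in> set rs" using zrs by auto
  then have pos: "z > 0" "last rs > 0" "hd rs > 0" using cyclic_structureD(2)[OF r] zrs by auto
  have "nat ((hd rs - 1) div z) = 0" "nat ((z - 1) div last rs) = Suc q"
    using m unfolding zrs(1) multiplicities_Cons[OF zrs(2)] by auto
  then have "(hd rs - 1) div z \<le> 0" "(z - 1) div last rs > 0" by auto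
  then have "hd rs \<le> z" "last rs < z"
    using pos by (simp_all add: pos_imp_zdiv_pos_iff)
      (smt (verit) pos_imp_zdiv_pos_iff)
  moreover have "z dvd last rs + hd rs"
    using cyclic_structureD(4)[OF r, of 0] zrs
    by (simp add: neighbour_sum_def last_conv_nth hd_conv_nth)
  then obtain c where c: "last rs + hd rs = z * c" by (auto elim: dvdE)
  \<comment> \<open>The cofactor \<open>c\<close> lies strictly between 0 and 2.\<close>
  ultimately have "z * c < z * 2" "z * 0 < z * c"
    using pos by (simp_all flip: c)
  then have "c = 1" using pos by (simp only: mult_less_cancel_left_pos)
  then have z: "z = last rs + hd rs" using c by simp
  have rs: "cyclic_structure rs" using r cyclic_structure_subdivide[OF zrs(2) pos(2)] z zrs by simp
  have "butlast (multiplicities rs) = y \<and> last (multiplicities rs) = q"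
    using m multiplicities_subdivide[OF zrs(2) cyclic_structureD(2)[OF rs]] by (simp add: zrs z)
  moreover have "multiplicities rs \<noteq> []" using zrs(2) by (metis length_multiplicities length_0_conv)
  ultimately have "multiplicities rs = y @ [q]" by (metis append_butlast_last_id)
  then show thesis using that zrs z rs by blast
qed

section \<open>The correspondence between structures and multiplicity sequences\<close>

lemma cyclic_structure_ones: "n > 0 \<Longrightarrow> cyclic_structure (replicate n 1)"
  by (simp add: cyclic_structure_def)

lemma multiplicities_ones: "multiplicities (replicate n 1) = replicate n 0"
  by (simp add: multiplicities_def)

text \<open>Otherwise every entry would be smaller than its successor, which is impossible around a
  cycle: \<open>r\<close> and \<open>rotate1 r\<close> have the same sum.\<close>

lemma zero_mem_multiplicities:
  assumes "cyclic_structure r"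
  shows "0 \<in> set (multiplicities r)"
proof (rule ccontr)
  assume 0: "0 \<notin> set (multiplicities r)"
  have "r ! i < rotate1 r ! i" if "i < length r" for i
  proof -
    have "multiplicities r ! i \<noteq> 0" using 0 that by (metis length_multiplicities nth_mem)
    then have "(rotate1 r ! i - 1) div r ! i > 0"
      using that by (simp add: nth_multiplicities nth_rotate1)
    then show ?thesis using cyclic_structureD(2)[OF assms] that by (simp add: pos_imp_zdiv_pos_iff)
  qed
  then have "(\<Sum>i<length r. r ! i) < (\<Sum>i<length r. rotate1 r ! i)"
    using cyclic_structureD(1)[OF assms] by (intro sum_strict_mono) auto
  then have "sum_list r < sum_list (rotate1 r)"
    by (simp add: sum_list_sum_nth atLeast0LessThan)
  then show False by (cases r) auto
qed

text \<open>No entry is smaller than its successor, so around the cycle all are equal, and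
  primitivity makes the common value 1.\<close>

lemma multiplicities_zero:
  assumes r: "cyclic_structure r" and z: "\<forall>x\<in>set (multiplicities r). x = 0"
  shows "r = replicate (length r) 1"
proof -
  have le: "rotate1 r ! i \<le> r ! i" if "i < length r" for i
  proof -
    have "multiplicities r ! i = 0" using z that by simp
    then have "\<not> (rotate1 r ! i - 1) div r ! i > 0"
      using that by (simp add: nth_multiplicities nth_rotate1)
    then show ?thesis using cyclic_structureD(2)[OF r] that by (simp add: pos_imp_zdiv_pos_iff)
  qed
  have "sum_list r = sum_list (rotate1 r)" by (cases r) auto
  then have s: "(\<Sum>i<length r. rotate1 r ! i) = (\<Sum>i<length r. r ! i)"
    by (simp add: sum_list_sum_nth atLeast0LessThan)
  have "rotate1 r ! i = r ! i" if "i < length r" for i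
    using sum_mono_inv[OF s] le that by auto
  then have "rotate1 r = r" by (intro nth_equalityI) auto
  then have "card (set r) = 1" using rotate1_fixpoint_card cyclic_structureD(1)[OF r] by blast
  then obtain c where c: "set r = {c}" by (auto simp: card_1_singleton_iff)
  then have "c = 1" using cyclic_structureD(2,3)[OF r] by auto
  then show ?thesis using c by (metis replicate_eqI singletonD)
qed

text \<open>If some multiplicity is nonzero, a suitable rotation admits a deletion, which shortens
  the list; closure under \<open>rotate1\<close> then undoes the rotation.\<close>

lemma cyclic_structure_induct [consumes 1, case_names ones subdivide rotate1]:
  assumes "cyclic_structure r"
    and ones: "\<And>n. n > 0 \<Longrightarrow> P (replicate n 1)"
    and subdivide: "\<And>rs. cyclic_structure rs \<Longrightarrow> P rs \<Longrightarrow> P ((last rs + hd rs) # rs)"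
    and rotate1: "\<And>r. P r \<Longrightarrow> P (rotate1 r)"
  shows "P r"
  using assms(1)
proof (induction r rule: length_induct)
  case (1 r)
  show ?case
  proof (cases "\<forall>x\<in>set (multiplicities r). x = 0")
    case True
    then have "r = replicate (length r) 1" using 1 multiplicities_zero by blast
    then show ?thesis using ones[of "length r"] cyclic_structureD(1)[OF 1(2)] by simp
  next
    case False
    then obtain j y q where "rotate j (multiplicities r) = 0 # y @ [Suc q]"
      using ex_rotate_hd_zero zero_mem_multiplicities[OF 1(2)] by blast
    then have "multiplicities (rotate j r) = 0 # y @ [Suc q]" by (simp add: multiplicities_rotate)
    then obtain rs where rs: "rotate j r = (last rs + hd rs) # rs" "cyclic_structure rs"
      using cyclic_structure_reduce[OF cyclic_structure_rotate[OF 1(2)]] by metis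
    have "length rs < length r" using arg_cong[OF rs(1), of length] by simp
    then have "P (rotate j r)" using 1(1) rs subdivide by simp
    then show ?thesis using rotate_induct[of P] rotate1 by blast
  qed
qed

text \<open>An insertion raises the length and the sum of the multiplicities by one each, and its
  entry, a sum of two positive integers, is not 1.\<close>

lemma sum_list_multiplicities:
  assumes "cyclic_structure r"
  shows "sum_list (multiplicities r) + count_list r 1 = length r"
  using assms
proof (induction r rule: cyclic_structure_induct)
  case (ones n)
  then show ?case by (simp add: multiplicities_ones sum_list_replicate count_list_eq_length_filter)
next
  case (subdivide rs)
  have ne: "rs \<noteq> []" using subdivide by (simp add: cyclic_structure_def)
  have "last rs > 0" "hd rs > 0" using ne cyclic_structureD(2)[OF subdivide(1)] by auto
  then have "last rs + hd rs \<noteq> 1" by simp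
  moreover have "multiplicities rs \<noteq> []" using ne by (metis length_multiplicities length_0_conv)
  then have "sum_list (multiplicities rs) =
      sum_list (butlast (multiplicities rs)) + last (multiplicities rs)"
    by (metis append_butlast_last_id sum_list.append sum_list.Cons sum_list.Nil add_0_right)
  ultimately show ?case
    using subdivide by (simp add: multiplicities_subdivide[OF ne cyclic_structureD(2)[OF subdivide(1)]])
next
  case (rotate1 r)
  have "count_list (rotate1 r) 1 = count_list r 1" by (cases r) auto
  then show ?case using rotate1 by (simp add: multiplicities_rotate1 sum_list_rotate1)
qed

text \<open>With \<open>sum_list_multiplicities\<close> this bounds the sum of the multiplicities
  strictly by the length.\<close>

lemma count_list_one_pos:
  assumes "cyclic_structure r"
  shows "count_list r 1 > 0"
  using assms
proof (induction r rule: cyclic_structure_induct)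
  case (ones n)
  then show ?case by (simp add: count_list_eq_length_filter)
next
  case (subdivide rs)
  then show ?case by simp
next
  case (rotate1 r)
  then show ?case by (cases r) auto
qed

text \<open>Equal multiplicities admit the same deletion, so \<open>s\<close> is taken apart in step
  with \<open>r\<close>; hence \<open>s\<close> is arbitrary in the induction.\<close>

lemma multiplicities_inj:
  assumes "cyclic_structure r" "cyclic_structure s" "multiplicities s = multiplicities r"
  shows "s = r"
  using assms
proof (induction r arbitrary: s rule: cyclic_structure_induct)
  case (ones n)
  have "length s = n" using arg_cong[OF ones(3), of length] by simp
  then show ?case using multiplicities_zero[OF ones(2)] ones by (simp add: multiplicities_ones)
next
  case (subdivide rs)
  have "rs \<noteq> []" using subdivide by (simp add: cyclic_structure_def)
  note m = multiplicities_subdivide[OF this cyclic_structureD(2)[OF subdivide(1)]]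
  have "multiplicities rs \<noteq> []" using \<open>rs \<noteq> []\<close> by (metis length_multiplicities length_0_conv)
  moreover obtain ss where "s = (last ss + hd ss) # ss" "cyclic_structure ss"
    "multiplicities ss = butlast (multiplicities rs) @ [last (multiplicities rs)]"
    using cyclic_structure_reduce[OF subdivide(3)] subdivide(4) m by metis
  ultimately show ?case using subdivide(2)[of ss] by simp
next
  case (rotate1 r)
  \<comment> \<open>The induction hypothesis concerns the list before rotation, so \<open>s\<close>
    must be rotated back by one, which \<open>k\<close> forward rotations achieve.\<close>
  obtain k where k: "rotate k (rotate 1 s) = s" using rotate_inverse by blast
  define s' where "s' = rotate k s"
  have s: "rotate1 s' = s" using k by (simp add: s'_def rotate1_rotate_swap)
  have "rotate1 (multiplicities s') = rotate1 (multiplicities r)"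
    using rotate1 s by (simp flip: multiplicities_rotate1)
  then have "multiplicities s' = multiplicities r" by (simp add: inj_eq[OF inj_rotate1])
  moreover have "cyclic_structure s'" using rotate1 by (simp add: s'_def cyclic_structure_rotate)
  ultimately show ?case using rotate1 s by metis
qed

text \<open>The bound forces a zero. Removing a zero that follows a positive entry and lowering that
  entry by one decreases sum and length equally, so the bound persists; subdividing the shorter
  structure restores \<open>x\<close> up to rotation.\<close>

lemma multiplicities_surj:
  assumes "sum_list x < length x"
  shows "\<exists>r. cyclic_structure r \<and> multiplicities r = x"
  using assms
proof (induction x rule: length_induct)
  case (1 x)
  have 0: "0 \<in> set x"
  proof (rule ccontr)
    assume "0 \<notin> set x"
    then have "length x \<le> sum_list x" by (induction x) auto
    with 1 show False by simp
  qed
  show ?case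
  proof (cases "\<forall>y\<in>set x. y = 0")
    case True
    then have "x = replicate (length x) 0" by (metis replicate_eqI)
    then show ?thesis using 1 multiplicities_ones cyclic_structure_ones by (metis not_less_zero not_gr_zero)
  next
    case False
    then obtain j y q where x: "rotate j x = 0 # y @ [Suc q]" using ex_rotate_hd_zero 0 by blast
    have "sum_list (rotate j x) = sum_list x"
      by (rule rotate_induct[where P = "\<lambda>w. sum_list (rotate j x) = sum_list w"]) (simp_all add: sum_list_rotate1)
    moreover have len: "length x = Suc (Suc (length y))" using arg_cong[OF x, of length] by simp
    ultimately have "sum_list (y @ [q]) < length (y @ [q])" using x 1 by simp
    then obtain rs where rs: "cyclic_structure rs" "multiplicities rs = y @ [q]"
      using 1(1) len by (metis length_append_singleton lessI)
    let ?r = "(last rs + hd rs) # rs"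
    have ne: "rs \<noteq> []" using rs by (simp add: cyclic_structure_def)
    then have "cyclic_structure ?r"
      using rs cyclic_structure_subdivide cyclic_structureD(2)[OF rs(1)] by simp
    moreover have "multiplicities ?r = rotate j x"
      using x multiplicities_subdivide[OF ne cyclic_structureD(2)[OF rs(1)]] rs(2) by simp
    moreover obtain k where "rotate k (rotate j x) = x" using rotate_inverse by blast
    ultimately show ?thesis using cyclic_structure_rotate multiplicities_rotate by metis
  qed
qed

section \<open>Translation between matrices and lists\<close>

lemma mod_pred_eq_iff:
  fixes i j n :: nat
  assumes "i < n" "j < n"
  shows "i = Suc j mod n \<longleftrightarrow> j = (i + n - 1) mod n"
proof (cases i)
  case 0
  then show ?thesis using assms by (auto simp: mod_Suc)
next
  case (Suc k)
  then have "(i + n - 1) mod n = k" using assms by simp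
  then show ?thesis using assms Suc by (auto simp: mod_Suc)
qed

lemma cycle_edges_iff:
  assumes "i < n" "j < n"
  shows "{i, j} \<in> cycle_edges n \<longleftrightarrow> j = Suc i mod n \<or> j = (i + n - 1) mod n"
  using assms mod_pred_eq_iff[OF assms] by (auto simp: cycle_edges_def doubleton_eq_iff)

text \<open>For \<open>n = 2\<close> the entry 2 matches a neighbour sum whose two neighbours
  coincide; otherwise a row has exactly two ones.\<close>

lemma cycle_adj_mult:
  assumes n: "n \<ge> 2" and r: "r \<in> carrier_vec n" and i: "i < n"
  shows "row (cycle_adj n) i \<bullet> r = neighbour_sum (list_of_vec r) i"
proof (cases "n = 2")
  case True
  then have "i = 0 \<or> i = 1" using i by auto
  then show ?thesis
    using True r by (auto simp: cycle_adj_def mat_of_rows_list_def scalar_prod_def neighbour_sum_def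
        list_of_vec_index numeral_2_eq_2)
next
  case False
  let ?p = "(i + n - 1) mod n" and ?s = "Suc i mod n"
  have ps: "?p < n" "?s < n" using n by simp_all
  \<comment> \<open>Coinciding neighbours would make two steps forward return to \<open>i\<close>,
    so \<open>n\<close> would divide 2.\<close>
  have "?p \<noteq> ?s"
  proof
    assume "?p = ?s"
    moreover have "i = Suc ?p mod n" using mod_pred_eq_iff[OF i ps(1)] by simp
    ultimately have "i = Suc (Suc i) mod n" by (simp add: mod_Suc_eq)
    then show False using False n i by (auto simp: mod_if split: if_splits)
  qed
  have "row (cycle_adj n) i \<bullet> r = (\<Sum>j<n. (if j \<in> {?p, ?s} then 1 else 0) * r $ j)"
    using r i False by (auto simp: cycle_adj_def scalar_prod_def cycle_edges_iff atLeast0LessThan intro!: sum.cong)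
  also have "\<dots> = (\<Sum>j\<in>{?p, ?s}. r $ j)"
    using ps by (intro sum.mono_neutral_cong_right) auto
  also have "\<dots> = r $ ?p + r $ ?s" using \<open>?p \<noteq> ?s\<close> by simp
  also have "\<dots> = neighbour_sum (list_of_vec r) i"
    using r ps by (simp add: neighbour_sum_def list_of_vec_index)
  finally show ?thesis .
qed

text \<open>Row \<open>i\<close> of the matrix equation gives the equation for
  \<open>d $ i * r $ i\<close>, which implies the divisibility. Positivity of \<open>d\<close>
  follows because neighbour sums of positive entries are positive.\<close>

lemma arithmetical_structures_cycle_iff:
  assumes n: "n \<ge> 2"
  shows "(d, r) \<in> arithmetical_structures n (cycle_adj n) \<longleftrightarrow>
    d \<in> carrier_vec n \<and> r \<in> carrier_vec n \<and> cyclic_structure (list_of_vec r) \<and>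
    (\<forall>i<n. d $ i * r $ i = neighbour_sum (list_of_vec r) i)"
proof (cases "d \<in> carrier_vec n \<and> r \<in> carrier_vec n")
  case True
  then have dim: "dim_vec d = n" "dim_vec r = n" by auto
  let ?A = "cycle_adj n"
  have A: "?A \<in> carrier_mat n n"
    by (auto simp: cycle_adj_def mat_of_rows_list_def)
  have "row (mat_diag n (\<lambda>i. d $ i)) i \<bullet> r = d $ i * r $ i" if "i < n" for i
  proof -
    have "row (mat_diag n (\<lambda>i. d $ i)) i \<bullet> r = (\<Sum>j<n. if j = i then d $ i * r $ i else 0)"
      using that dim unfolding scalar_prod_def
      by (intro sum.cong) (auto simp: mat_diag_def)
    then show ?thesis using that by simp
  qed
  moreover have "((mat_diag n (\<lambda>i. d $ i) - ?A) *\<^sub>v r) $ i =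
      row (mat_diag n (\<lambda>i. d $ i)) i \<bullet> r - row ?A i \<bullet> r" if "i < n" for i
    using that A True
    by (subst minus_mult_distrib_mat_vec[OF mat_diag_dim A]) (auto simp: mat_diag_def)
  ultimately have "((mat_diag n (\<lambda>i. d $ i) - ?A) *\<^sub>v r) $ i =
      d $ i * r $ i - neighbour_sum (list_of_vec r) i" if "i < n" for i
    using that cycle_adj_mult[OF n] True by simp
  then have eq: "(mat_diag n (\<lambda>i. d $ i) - ?A) *\<^sub>v r = 0\<^sub>v n \<longleftrightarrow>
      (\<forall>i<n. d $ i * r $ i = neighbour_sum (list_of_vec r) i)"
    using A by (auto simp: vec_eq_iff)
  have pos: "(\<forall>x\<in>set (list_of_vec r). x > 0) \<longleftrightarrow> (\<forall>i<n. r $ i > 0)"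
    using dim by (auto simp: set_list_of_vec vec_set_def)
  have "d $ i > 0" if "\<forall>i<n. r $ i > 0" "d $ i * r $ i = neighbour_sum (list_of_vec r) i" "i < n" for i
  proof -
    have "neighbour_sum (list_of_vec r) i > 0"
      unfolding neighbour_sum_def using that dim by (intro add_pos_pos) (simp_all add: list_of_vec_index)
    then show ?thesis using that by (metis zero_less_mult_pos2)
  qed
  then have "(d, r) \<in> arithmetical_structures n ?A \<longleftrightarrow> (\<forall>i<n. r $ i > 0) \<and>
      Gcd (set\<^sub>v r) = 1 \<and> (\<forall>i<n. d $ i * r $ i = neighbour_sum (list_of_vec r) i)"
    using True eq by (auto simp: arithmetical_structures_def)
  moreover have "length (list_of_vec r) = n" using dim by simp
  then have "list_of_vec r \<noteq> []" using n by (metis list.size(3) not_numeral_le_zero)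
  then have "cyclic_structure (list_of_vec r) \<longleftrightarrow> (\<forall>i<n. r $ i > 0) \<and>
      Gcd (set\<^sub>v r) = 1 \<and> (\<forall>i<n. r $ i dvd neighbour_sum (list_of_vec r) i)"
    using dim pos by (simp add: cyclic_structure_def set_list_of_vec list_of_vec_index)
  moreover have "r $ i dvd neighbour_sum (list_of_vec r) i"
    if "d $ i * r $ i = neighbour_sum (list_of_vec r) i" for i
    using that by (metis dvd_triv_right)
  ultimately show ?thesis using True by blast
next
  case False
  then show ?thesis by (auto simp: arithmetical_structures_def)
qed

section \<open>Counting structures through their multiplicities\<close>

lemma num_ones_eq_count_list: "num_ones r = count_list (list_of_vec r) 1"
  by (auto simp: num_ones_def count_list_eq_length_filter length_filter_conv_card list_of_vec_index
      intro!: arg_cong[of _ _ card])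

text \<open>Sum \<open>n - k\<close> corresponds to \<open>k\<close> ones, so the strict bound
  expresses \<open>k \<ge> 1\<close>.\<close>

lemma bij_betw_multiplicities:
  assumes n: "n \<ge> 2"
  shows "bij_betw (\<lambda>(d, r). multiplicities (list_of_vec r))
    (arithmetical_structures n (cycle_adj n)) {x. length x = n \<and> sum_list x < n}"
  unfolding bij_betw_def
proof (intro conjI)
  let ?S = "arithmetical_structures n (cycle_adj n)"
  note S = arithmetical_structures_cycle_iff[OF n]
  show "inj_on (\<lambda>(d, r). multiplicities (list_of_vec r)) ?S"
  proof (rule inj_onI, clarify)
    fix d r d' r'
    assume dr: "(d, r) \<in> ?S" "(d', r') \<in> ?S"
      and eq: "multiplicities (list_of_vec r) = multiplicities (list_of_vec r')"
    then have "list_of_vec r = list_of_vec r'" by (intro multiplicities_inj) (simp_all add: S)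
    then have r: "r = r'" by (metis vec_list)
    have "d $ i = d' $ i" if "i < n" for i
    proof -
      have "d $ i * r $ i = d' $ i * r $ i" using dr that r by (simp add: S)
      moreover have "r $ i > 0" using dr that by (simp add: arithmetical_structures_def)
      ultimately show ?thesis by simp
    qed
    then have "d = d'" using dr by (intro eq_vecI) (auto simp: S)
    with r show "d = d' \<and> r = r'" by simp
  qed
  show "(\<lambda>(d, r). multiplicities (list_of_vec r)) ` ?S = {x. length x = n \<and> sum_list x < n}"
  proof (intro equalityI subsetI)
    fix x assume "x \<in> (\<lambda>(d, r). multiplicities (list_of_vec r)) ` ?S"
    then obtain r where r: "r \<in> carrier_vec n" "cyclic_structure (list_of_vec r)"
      "x = multiplicities (list_of_vec r)" by (auto simp: S)
    then show "x \<in> {x. length x = n \<and> sum_list x < n}"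
      using sum_list_multiplicities[OF r(2)] count_list_one_pos[OF r(2)] by auto
  next
    fix x assume "x \<in> {x. length x = n \<and> sum_list x < n}"
    then have x: "length x = n" "sum_list x < length x" by auto
    from multiplicities_surj[OF x(2)] obtain l where "cyclic_structure l" "multiplicities l = x"
      by blast
    with x have l: "cyclic_structure l" "multiplicities l = x" "length l = n" by auto
    \<comment> \<open>The divisibility conditions make these quotients exact.\<close>
    let ?d = "vec n (\<lambda>i. neighbour_sum l i div l ! i)"
    have "(?d, vec_of_list l) \<in> ?S"
      using l cyclic_structureD(4)[OF l(1)]
      by (auto simp: S list_vec vec_of_list_index carrier_dim_vec)
    then show "x \<in> (\<lambda>(d, r). multiplicities (list_of_vec r)) ` ?S"
      using l(2) by (force simp: list_vec)
  qed
qed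

theorem theorem3p7:
  fixes n :: nat
  assumes "n \<ge> 2"
  shows "(\<forall>k. 1 \<le> k \<and> k \<le> n \<longrightarrow>
            card {(d, r) \<in> arithmetical_structures n (cycle_adj n). num_ones r = k}
              = (2 * n - k - 1) choose (n - k) \<and>
            (2 * n - k - 1) choose (n - k) = card (multisets_of_size {1..n} (n - k))) \<and>
         finite (arithmetical_structures n (cycle_adj n)) \<and>
         card (arithmetical_structures n (cycle_adj n)) = (2 * n - 1) choose (n - 1)"
proof -
  let ?S = "arithmetical_structures n (cycle_adj n)"
  let ?f = "\<lambda>(d :: int vec, r). multiplicities (list_of_vec r)"
  let ?B = "{x :: nat list. length x = n \<and> sum_list x < n}"
  let ?L = "\<lambda>m. {x :: nat list. length x = n \<and> sum_list x = m}"
  have bij: "bij_betw ?f ?S ?B" by (rule bij_betw_multiplicities[OF assms])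
  have ones: "sum_list (?f a) + num_ones (snd a) = n" if "a \<in> ?S" for a
    using that sum_list_multiplicities
    by (cases a) (auto simp: arithmetical_structures_cycle_iff[OF assms] num_ones_eq_count_list)
  have fibre: "card {(d, r) \<in> ?S. num_ones r = k} = (2 * n - k - 1) choose (n - k)"
    if k: "1 \<le> k" "k \<le> n" for k
  proof -
    have "bij_betw ?f {a \<in> ?S. num_ones (snd a) = k} {x \<in> ?B. sum_list x = n - k}"
    proof (rule bij_betw_Collect[OF bij])
      fix a assume "a \<in> ?S"
      from ones[OF this] show "sum_list (?f a) = n - k \<longleftrightarrow> num_ones (snd a) = k"
        using k by linarith
    qed
    then have "card {a \<in> ?S. num_ones (snd a) = k} = card {x \<in> ?B. sum_list x = n - k}"
      by (rule bij_betw_same_card)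
    also have "{x \<in> ?B. sum_list x = n - k} = ?L (n - k)" using assms k by auto
    also have "{a \<in> ?S. num_ones (snd a) = k} = {(d, r) \<in> ?S. num_ones r = k}" by auto
    finally have "card {(d, r) \<in> ?S. num_ones r = k} = card (?L (n - k))" .
    \<comment> \<open>Stars and bars produces the upper index in the form on the left.\<close>
    moreover have "n - k + n - 1 = 2 * n - k - 1" using k by simp
    ultimately show ?thesis by (simp add: card_length_sum_list)
  qed
  have multisets: "(2 * n - k - 1) choose (n - k) = card (multisets_of_size {1..n} (n - k))"
    if "1 \<le> k" "k \<le> n" for k
  proof -
    have "n + (n - k) - 1 = 2 * n - k - 1" using that by simp
    then show ?thesis by (simp add: card_multisets_of_size)
  qed
  have fin: "finite (?L m)" for m
    by (rule finite_subset[OF _ finite_lists_length_eq[of "{..m}" n]]) (auto dest: member_le_sum_list)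
  have B: "?B = (\<Union>m\<le>n - 1. ?L m)" using assms by auto
  have "card ?B = (\<Sum>m\<le>n - 1. (n - 1 + m) choose m)"
    unfolding B using assms
    by (subst card_UN_disjoint) (auto simp: fin card_length_sum_list add.commute intro!: sum.cong)
  also have "\<dots> = (2 * n - 1) choose (n - 1)"
  proof -
    \<comment> \<open>Hockey-stick summation with both parameters equal to
      \<open>n - 1\<close>.\<close>
    obtain p where "n = Suc p" using assms by (cases n) auto
    then show ?thesis using sum_choose_lower[of p p] by (simp add: mult_2)
  qed
  finally have "card ?B = (2 * n - 1) choose (n - 1)" .
  moreover have "finite ?B" unfolding B using fin by blast
  ultimately have "finite ?S" "card ?S = (2 * n - 1) choose (n - 1)"
    using bij_betw_finite[OF bij] bij_betw_same_card[OF bij] by simp_all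
  with fibre multisets show ?thesis by blast
qed

end
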